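(* For every name $Q$, $\mathrm{InteriorG}(Q)\subseteq Q$.
   Context: Logic is classical. Names form a type $N$; a name may designate zero, one or several objects. The relation $\eta : N\to N\to \mathrm{Prop}$ (singular inclusion) is governed by Leśniewski's Ontology: $\eta\,A\,b$ holds iff [there is $C$ with $\eta\,C\,A$] and [for all $C,D$, $\eta\,C\,A$ and $\eta\,D\,A$ imply $\eta\,C\,D$] and [for all $C$, $\eta\,C\,A$ implies $\eta\,C\,b$]; i.e. $A$ designates exactly one object, which is among those designated by $b$. $A$ is an Individual iff $\eta\,A\,A$. Notation: $P\equiv Q$ iff $\eta\,P\,Q$ and $\eta\,Q\,P$; $a\approx b$ iff $\forall P,\ \eta\,P\,a\leftrightarrow\eta\,P\,b$; $a\subseteq b$ iff $\forall P,\ \eta\,P\,a\to\eta\,P\,b$. Names with the same extension are interchangeable. Name-forming operators are introduced by stating when $\eta\,P\,(\cdot)$ holds. Mereology: $\eta\,P\,(\mathrm{pt}(Q))$ ("$P$ is a part of $Q$") relates individuals and is reflexive on individuals, transitive, and antisymmetric up to $\equiv$; $\eta\,P\,(\mathrm{ppt}(Q))$ (proper part) means $\eta\,P\,(\mathrm{pt}(Q))$ and not $P\equiv Q$; $\eta\,P\,(\mathrm{ext}(Q))$ means $P,Q$ are individuals with no common part. $\eta\,A\,(\mathrm{klass}(a))$ iff $A$ is an Individual, every $B$ with $\eta\,B\,a$ satisfies $\eta\,B\,(\mathrm{pt}(A))$, and for every $B$ with $\eta\,B\,(\mathrm{pt}(A))$ there exist $C,D$ with $\eta\,C\,a$, $\eta\,D\,(\mathrm{pt}(C))$,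 $\eta\,D\,(\mathrm{pt}(B))$. If some $C$ satisfies $\eta\,C\,a$, then there is $A$ with $\eta\,A\,(\mathrm{klass}(a))$, unique up to $\equiv$. Geometry: $\mathrm{balls}$ is a primitive name whose members are individuals (balls); at least one ball exists. $\eta\,P\,(\mathrm{Concent}(Q))$ means that the balls $P,Q$ are concentric in Tarski's sense: $P\equiv Q$; or $P$ is a proper part of $Q$ and any two balls $X,Y$ externally diametrical to $P$ and internally tangent to $Q$ are internally diametrical to $Q$; or the same with $P,Q$ exchanged. Here (all variables balls): $A$ is externally tangent to $B$ if $A$ is external to $B$ and of any two balls $X,Y$ having $A$ as part and external to $B$ one is part of the other; $A$ is internally tangent to $B$ if $A$ is a proper part of $B$ and of any two balls $X,Y$ having $A$ as part and being parts of $B$ one is part of the other; $A,B$ are externally diametrical to $C$ if both are externally tangent to $C$ and whenever $X,Y$ are external to $C$, $A$ is part of $X$ and $B$ is part of $Y$, then $X$ is external to $Y$; $A,B$ are internally diametrical to $C$ if both are internally tangent to $C$ and whenever $X,Y$ are external to $C$, $A$ is externally tangent to $X$ and $B$ to $Y$, then $X$ is external to $Y$. $\eta\,P\,(\mathrm{Point}(Q))$ iff $\eta\,P\,\mathrm{balls}$, $\eta\,Q\,\mathrm{balls}$ and $\eta\,P\,(\mathrm{Concent}(Q))$. Standing assumptions: concentricity is an equivalence relation on balls, and concentric balls $P,Q$ satisfy $\mathrm{Point}(P)\approx\mathrm{Point}(Q)$. $\eta\,P\,\mathrm{Solid}$ iff $P$ is an Individual and there is $b\subseteq\mathrm{balls}$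 with $\eta\,P\,(\mathrm{klass}(b))$; parts of solids are assumed to be solids. $\eta\,P\,(\mathrm{sat\_InteriorPoint}(Q))$ iff $\eta\,Q\,\mathrm{Solid}$ and there is $P'$ with $\eta\,P\,(\mathrm{Point}(P'))$, $\eta\,P'\,(\mathrm{pt}(Q))$, and ($\eta\,P'\,(\mathrm{pt}(P))\to P\equiv P'$). $\eta\,P\,(\mathrm{InteriorG}(Q))$ iff $\eta\,P\,(\mathrm{klass}(\mathrm{sat\_InteriorPoint}(Q)))$. *)

theory Defs
  imports Main
begin

text \<open>
  Names are the elements of a type \<^typ>\<open>'n\<close>; a name may designate zero, one or several objects.
  A name-forming operator is a parameter of type \<^typ>\<open>'n \<Rightarrow> 'n\<close> (or \<^typ>\<open>'n\<close>, for a constant name)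
  together with an assumption stating when \<open>\<eta> P\<close> holds of its value; as coextensional names are
  equal, such an assumption determines the operator uniquely.
\<close>

locale names =
  fixes \<eta> :: "'n \<Rightarrow> 'n \<Rightarrow> bool"
begin

definition Individual :: "'n \<Rightarrow> bool" where
  "Individual A \<longleftrightarrow> \<eta> A A"

definition same :: "'n \<Rightarrow> 'n \<Rightarrow> bool" (infix \<open>\<equiv>\<^sub>\<eta>\<close> 50) where
  "P \<equiv>\<^sub>\<eta> Q \<longleftrightarrow> \<eta> P Q \<and> \<eta> Q P"

definition coext :: "'n \<Rightarrow> 'n \<Rightarrow> bool" (infix \<open>\<approx>\<^sub>\<eta>\<close> 50) where
  "a \<approx>\<^sub>\<eta> b \<longleftrightarrow> (\<forall>P. \<eta> P a \<longleftrightarrow> \<eta> P b)"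

definition incl :: "'n \<Rightarrow> 'n \<Rightarrow> bool" (infix \<open>\<subseteq>\<^sub>\<eta>\<close> 50) where
  "a \<subseteq>\<^sub>\<eta> b \<longleftrightarrow> (\<forall>P. \<eta> P a \<longrightarrow> \<eta> P b)"

end

locale ontology = names \<eta> for \<eta> :: "'n \<Rightarrow> 'n \<Rightarrow> bool" +
  assumes eta_iff:
    "\<eta> A b \<longleftrightarrow> (\<exists>C. \<eta> C A) \<and> (\<forall>C D. \<eta> C A \<and> \<eta> D A \<longrightarrow> \<eta> C D) \<and> (\<forall>C. \<eta> C A \<longrightarrow> \<eta> C b)"
    and extensionality: "a \<approx>\<^sub>\<eta> b \<Longrightarrow> a = b"

locale mereology = ontology \<eta> for \<eta> :: "'n \<Rightarrow> 'n \<Rightarrow> bool" +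
  fixes pt ppt ext klass :: "'n \<Rightarrow> 'n"
  assumes pt_individuals: "\<eta> P (pt Q) \<Longrightarrow> Individual P \<and> Individual Q"
    and pt_refl: "Individual P \<Longrightarrow> \<eta> P (pt P)"
    and pt_trans: "\<eta> P (pt Q) \<Longrightarrow> \<eta> Q (pt R) \<Longrightarrow> \<eta> P (pt R)"
    and pt_antisym: "\<eta> P (pt Q) \<Longrightarrow> \<eta> Q (pt P) \<Longrightarrow> P \<equiv>\<^sub>\<eta> Q"
    and ppt_iff: "\<eta> P (ppt Q) \<longleftrightarrow> \<eta> P (pt Q) \<and> \<not> P \<equiv>\<^sub>\<eta> Q"
    and ext_iff: "\<eta> P (ext Q) \<longleftrightarrow>
      Individual P \<and> Individual Q \<and> \<not> (\<exists>R. \<eta> R (pt P) \<and> \<eta> R (pt Q))"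
    and klass_iff: "\<eta> A (klass a) \<longleftrightarrow>
      Individual A \<and> (\<forall>B. \<eta> B a \<longrightarrow> \<eta> B (pt A)) \<and>
      (\<forall>B. \<eta> B (pt A) \<longrightarrow> (\<exists>C D. \<eta> C a \<and> \<eta> D (pt C) \<and> \<eta> D (pt B)))"
    and klass_exists: "\<eta> C a \<Longrightarrow> \<exists>A. \<eta> A (klass a)"
    and klass_unique: "\<eta> C a \<Longrightarrow> \<eta> A (klass a) \<Longrightarrow> \<eta> A' (klass a) \<Longrightarrow> A \<equiv>\<^sub>\<eta> A'"

locale ball_geometry = mereology \<eta> pt ppt ext klass
  for \<eta> :: "'n \<Rightarrow> 'n \<Rightarrow> bool" and pt ppt ext klass :: "'n \<Rightarrow> 'n" +
  fixes balls :: "'n"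
  assumes balls_individuals: "\<eta> B balls \<Longrightarrow> Individual B"
    and balls_nonempty: "\<exists>B. \<eta> B balls"
begin

definition externally_tangent :: "'n \<Rightarrow> 'n \<Rightarrow> bool" where
  "externally_tangent A B \<longleftrightarrow> \<eta> A balls \<and> \<eta> B balls \<and> \<eta> A (ext B) \<and>
    (\<forall>X Y. \<eta> X balls \<and> \<eta> Y balls \<and>
       \<eta> A (pt X) \<and> \<eta> X (ext B) \<and> \<eta> A (pt Y) \<and> \<eta> Y (ext B) \<longrightarrow>
       \<eta> X (pt Y) \<or> \<eta> Y (pt X))"

definition internally_tangent :: "'n \<Rightarrow> 'n \<Rightarrow> bool" where
  "internally_tangent A B \<longleftrightarrow> \<eta> A balls \<and> \<eta> B balls \<and> \<eta> A (ppt B) \<and>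
    (\<forall>X Y. \<eta> X balls \<and> \<eta> Y balls \<and>
       \<eta> A (pt X) \<and> \<eta> X (pt B) \<and> \<eta> A (pt Y) \<and> \<eta> Y (pt B) \<longrightarrow>
       \<eta> X (pt Y) \<or> \<eta> Y (pt X))"

definition externally_diametrical :: "'n \<Rightarrow> 'n \<Rightarrow> 'n \<Rightarrow> bool" where
  "externally_diametrical A B C \<longleftrightarrow> externally_tangent A C \<and> externally_tangent B C \<and>
    (\<forall>X Y. \<eta> X balls \<and> \<eta> Y balls \<and>
       \<eta> X (ext C) \<and> \<eta> Y (ext C) \<and> \<eta> A (pt X) \<and> \<eta> B (pt Y) \<longrightarrow> \<eta> X (ext Y))"

definition internally_diametrical :: "'n \<Rightarrow> 'n \<Rightarrow> 'n \<Rightarrow> bool" where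
  "internally_diametrical A B C \<longleftrightarrow> internally_tangent A C \<and> internally_tangent B C \<and>
    (\<forall>X Y. \<eta> X balls \<and> \<eta> Y balls \<and>
       \<eta> X (ext C) \<and> \<eta> Y (ext C) \<and> externally_tangent A X \<and> externally_tangent B Y \<longrightarrow>
       \<eta> X (ext Y))"

definition concentric_within :: "'n \<Rightarrow> 'n \<Rightarrow> bool" where
  "concentric_within P Q \<longleftrightarrow> \<eta> P (ppt Q) \<and>
    (\<forall>X Y. \<eta> X balls \<and> \<eta> Y balls \<and> externally_diametrical X Y P \<and>
       internally_tangent X Q \<and> internally_tangent Y Q \<longrightarrow>
       internally_diametrical X Y Q)"

end

locale solid_geometry = ball_geometry \<eta> pt ppt ext klass balls
  for \<eta> :: "'n \<Rightarrow> 'n \<Rightarrow> bool" and pt ppt ext klass :: "'n \<Rightarrow> 'n" and balls :: "'n" +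
  fixes Concent Point :: "'n \<Rightarrow> 'n"
    and Solid :: "'n"
    and sat_InteriorPoint InteriorG :: "'n \<Rightarrow> 'n"
  assumes Concent_iff: "\<eta> P (Concent Q) \<longleftrightarrow> \<eta> P balls \<and> \<eta> Q balls \<and>
      (P \<equiv>\<^sub>\<eta> Q \<or> concentric_within P Q \<or> concentric_within Q P)"
    and Point_iff: "\<eta> P (Point Q) \<longleftrightarrow> \<eta> P balls \<and> \<eta> Q balls \<and> \<eta> P (Concent Q)"
    and Concent_equiv: "equiv {P. \<eta> P balls} {(P, Q). \<eta> P (Concent Q)}"
    and Point_cong: "\<eta> P (Concent Q) \<Longrightarrow> Point P \<approx>\<^sub>\<eta> Point Q"
    and Solid_iff: "\<eta> P Solid \<longleftrightarrow> Individual P \<and> (\<exists>b. b \<subseteq>\<^sub>\<eta> balls \<and> \<eta> P (klass b))"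
    and parts_of_solids: "\<eta> Q Solid \<Longrightarrow> \<eta> P (pt Q) \<Longrightarrow> \<eta> P Solid"
    and sat_InteriorPoint_iff: "\<eta> P (sat_InteriorPoint Q) \<longleftrightarrow> \<eta> Q Solid \<and>
      (\<exists>P'. \<eta> P (Point P') \<and> \<eta> P' (pt Q) \<and> (\<eta> P' (pt P) \<longrightarrow> P \<equiv>\<^sub>\<eta> P'))"
    and InteriorG_iff: "\<eta> P (InteriorG Q) \<longleftrightarrow> \<eta> P (klass (sat_InteriorPoint Q))"

end

theory Submission
  imports Defs
begin

text \<open>
  If \<open>InteriorG Q\<close> designates nothing, the inclusion is vacuous. Otherwise \<open>Q\<close> has an interior
  point, hence is a solid, and then \<open>Q\<close> is itself the class of its interior points; as classes are
  unique, whatever \<open>InteriorG Q\<close> designates is identical with \<open>Q\<close>.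

  Two facts make \<open>Q\<close> that class. A ball representing an interior point of \<open>Q\<close> is concentric with a
  ball inside \<open>Q\<close> and does not properly contain it; concentric balls are comparable, so it lies
  inside \<open>Q\<close> (\<open>interior_point_part\<close>). Conversely, every ball inside \<open>Q\<close> represents its own centre,
  which is an interior point of \<open>Q\<close>, and every part of \<open>Q\<close>, being a solid, contains a ball
  (\<open>solid_has_ball_part\<close>).
\<close>

context ontology
begin

lemma eta_trans: "\<eta> A B \<Longrightarrow> \<eta> B c \<Longrightarrow> \<eta> A c"
  using eta_iff[of B c] by blast

end

context mereology
begin

text \<open>An individual is a part of itself, and each of its parts overlaps a member.\<close>
lemma klass_has_member:
  assumes "\<eta> A (klass a)"
  obtains C where "\<eta> C a"
  using assms klass_iff[of A a] pt_refl[of A] by blast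

end

context solid_geometry
begin

text \<open>
  Of two concentric balls one is a part of the other; the last condition on \<open>P'\<close> excludes that \<open>P\<close>
  is the properly larger one.
\<close>
lemma interior_point_part:
  assumes "\<eta> P (sat_InteriorPoint Q)"
  shows "\<eta> P (pt Q)"
proof -
  obtain P' where conc: "\<eta> P (Concent P')" and P'Q: "\<eta> P' (pt Q)"
    and min: "\<eta> P' (pt P) \<longrightarrow> P \<equiv>\<^sub>\<eta> P'"
    using assms sat_InteriorPoint_iff Point_iff by blast
  have "P \<equiv>\<^sub>\<eta> P' \<or> \<eta> P (ppt P')"
    using conc min Concent_iff[of P P'] ppt_iff[of P' P] unfolding concentric_within_def by blast
  then show ?thesis
  proof
    assume "P \<equiv>\<^sub>\<eta> P'"
    then show ?thesis
      using P'Q eta_trans unfolding same_def by blast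
  next
    assume "\<eta> P (ppt P')"
    then show ?thesis
      using P'Q ppt_iff pt_trans by blast
  qed
qed

text \<open>A solid is a class of balls, and all members of a class are parts of it.\<close>
lemma solid_has_ball_part:
  assumes "\<eta> S Solid"
  obtains B where "\<eta> B balls" "\<eta> B (pt S)"
proof -
  obtain b where b: "b \<subseteq>\<^sub>\<eta> balls" "\<eta> S (klass b)"
    using assms Solid_iff by blast
  obtain B where "\<eta> B b"
    using b(2) klass_has_member by blast
  then show ?thesis
    using b that klass_iff[of S b] unfolding incl_def by blast
qed

text \<open>The ball itself is the witness for \<open>P'\<close>, since a ball is concentric with itself.\<close>
lemma ball_part_is_interior_point:
  assumes "\<eta> Q Solid" "\<eta> B balls" "\<eta> B (pt Q)"
  shows "\<eta> B (sat_InteriorPoint Q)"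
proof -
  have "B \<equiv>\<^sub>\<eta> B"
    using balls_individuals[OF assms(2)] unfolding Individual_def same_def by simp
  then show ?thesis
    using assms sat_InteriorPoint_iff Point_iff Concent_iff by blast
qed

lemma solid_is_klass_of_interior_points:
  assumes "\<eta> Q Solid"
  shows "\<eta> Q (klass (sat_InteriorPoint Q))"
proof -
  have "\<exists>C D. \<eta> C (sat_InteriorPoint Q) \<and> \<eta> D (pt C) \<and> \<eta> D (pt B)" if B: "\<eta> B (pt Q)" for B
  proof -
    obtain C where C: "\<eta> C balls" "\<eta> C (pt B)"
      using solid_has_ball_part[OF parts_of_solids[OF assms B]] by blast
    have "\<eta> C (sat_InteriorPoint Q)"
      using ball_part_is_interior_point[OF assms C(1)] pt_trans[OF C(2) B] by blast
    then show ?thesis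
      using C balls_individuals pt_refl by blast
  qed
  then show ?thesis
    using klass_iff interior_point_part assms Solid_iff by blast
qed

lemma InteriorG_incl: "InteriorG Q \<subseteq>\<^sub>\<eta> Q"
  unfolding incl_def
proof (intro allI impI)
  fix P assume "\<eta> P (InteriorG Q)"
  then have P: "\<eta> P (klass (sat_InteriorPoint Q))"
    using InteriorG_iff by blast
  then obtain C where C: "\<eta> C (sat_InteriorPoint Q)"
    using klass_has_member by blast
  (* only solids have interior points *)
  then have "\<eta> Q Solid"
    using sat_InteriorPoint_iff by blast
  then have "P \<equiv>\<^sub>\<eta> Q"
    using klass_unique[OF C P] solid_is_klass_of_interior_points by blast
  then show "\<eta> P Q"
    unfolding same_def by blast
qed

end

theorem theorem12:
  fixes \<eta> :: "'n \<Rightarrow> 'n \<Rightarrow> bool"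
    and pt ppt ext klass Concent Point sat_InteriorPoint InteriorG :: "'n \<Rightarrow> 'n"
    and balls Solid Q :: "'n"
  assumes "solid_geometry \<eta> pt ppt ext klass balls Concent Point Solid sat_InteriorPoint InteriorG"
  shows "names.incl \<eta> (InteriorG Q) Q"
  using assms by (rule solid_geometry.InteriorG_incl)

end
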